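(* Let $T>0$. There is a constant $C_T>0$ (depending on $T$, not on $N$) such that for every $k\le NT$ $$\|V^N_k-H^N_k\|=|v^N_k-u^N_k|\le\frac{C_T}{N^{1-\beta-\gamma}},$$ and there is a constant $C>0$ (not depending on $N$ or $k$) such that for every $k\ge0$ $$\mathbb E\|H^N_k-H_k\|^2=\mathbb E|u^N_k-u_k|^2\le\frac CN .$$
   Context: Data. $d,d_z,d_\eta\ge1$ are integers. $(X_k,Z_k)_{k\ge0}$ is a time-homogeneous Markov chain in $\mathbb R^d\times\mathbb R^{d_z}$ with transition kernel $P$; $(\eta_k)_{k\ge0}$ are i.i.d. in $\mathbb R^{d_\eta}$, independent of $(X_k,Z_k)_{k\ge0}$; $Y_k=f(X_k,Z_k,\eta_k)\in\mathbb R$. Assumed: (i) there is $L<1$ with $\mathsf W_2(P((x,z),\cdot),P((\tilde x,\tilde z),\cdot))\le L|(x,z)-(\tilde x,\tilde z)|$ for all $(x,z),(\tilde x,\tilde z)$, where $\mathsf W_2$ is the 2-Wasserstein distance for the Euclidean norm; (ii) $|(X_k,Z_k)|\le C_x<\infty$ for all $k$; (iii) $\mathbb E|\eta_k|^2<\infty$; (iv) $f$ is bounded and Lipschitz. Activation and initialisation. $\sigma\in C^2_b(\mathbb R)$ (bounded, twice continuously differentiable, bounded derivatives), $C_{\sigma'}=\sup|\sigma'|$. For each $N$, $(C^i_0,W^i_0,B^i_0)_{i=1}^N$ in $\mathbb R\times\mathbb R^d\times\mathbb R$ are i.i.d. with law $\lambda$ (absolutely continuous w.r.t. Lebesgue measure),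 independent of $(X_k,Z_k,\eta_k)_{k\ge0}$; for each $i$, $C^i_0,W^i_0,B^i_0$ are mutually independent; $|C^i_0|\le K_c$, $\mathbb E C^i_0=0$, $\mathbb E[(C^i_0)^2]=\mu_{c^2}$, $|B^i_0|\le K_b$, $\mathbb E B^i_0=\mu_b$, $\mathbb E[(B^i_0)^2]=\mu_{b^2}$, $\mathbb E|W^i_0|^2=\mu_{w^2}$, all constants in $(0,\infty)$, with $\mu_b^2\le\mu_{b^2}\le K_b^2$, $\mu_{c^2}\le K_c^2$, $2K_b^2C_{\sigma'}^2<1$ and $q_0:=\sqrt{\max\{L^2+2\mu_b^2\mu_{w^2}C_{\sigma'}^2,\;2\mu_b^2C_{\sigma'}^2\}}<1$. $\lambda(dw)$ denotes the marginal law of $W^i_0$. Training. Fix $\alpha>0$, $\beta\in(1/2,1)$, $\gamma\in(0,(1-\beta)/2)$, and clipping functions $\psi^N\in C^2_b(\mathbb R)$ with $|\psi^N|\le2N^\gamma$, $\psi^N(x)=x$ for $|x|\le N^\gamma$, $|(\psi^N)'|\le1$. With $\hat S^{i,N}_0=0$, for $k\ge0$ and $1\le i\le N$ let $\hat S^{i,N}_{k+1}=\sigma\big((W^i_k)^\top X_k+\frac1N\sum_{j}B^j_k\hat S^{j,N}_k\big)$, $\Delta\hat S^{i,N}_{k+1}=\sigma'\big((W^i_k)^\top X_k+\frac1N\sum_{j}B^j_k\hat S^{j,N}_k\big)$, $\hat Y^N_k=N^{-\beta}\sum_iC^i_k\hat S^{i,N}_{k+1}$, $C^i_{k+1}=C^i_k-\frac{\alpha}{N^{2-\beta}}(\psi^N(\hat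 Y^N_k)-Y_k)\hat S^{i,N}_{k+1}$, $W^i_{k+1}=W^i_k-\frac{\alpha C^i_k}{N^{2-\beta}}(\psi^N(\hat Y^N_k)-Y_k)\Delta\hat S^{i,N}_{k+1}X_k$, $B^i_{k+1}=B^i_k-\frac{\alpha}{N^{3-\beta}}(\psi^N(\hat Y^N_k)-Y_k)\sum_{\ell}C^\ell_k\hat S^{\ell,N}_k\Delta\hat S^{\ell,N}_{k+1}$. Memory terms. For $k\ge1$: trained, $v^N_k=\frac1N\sum_{j=1}^NB^j_k\,\sigma((W^j_{k-1})^\top X_{k-1}+v^N_{k-1})$, $v^N_0=0$ (so $\hat S^{i,N}_{k+1}=\sigma((W^i_k)^\top X_k+v^N_k)$); untrained, $u^N_k=\frac1N\sum_{j=1}^NB^j_0\,\sigma((W^j_0)^\top X_{k-1}+u^N_{k-1})$, $u^N_0=0$; mean-field, $u_k=\mu_b\int_{\mathbb R^d}\sigma(w^\top X_{k-1}+u_{k-1})\lambda(dw)$, $u_0=0$. Set $V^N_k=(X_k,Z_k,Y_k,v^N_k)$, $H^N_k=(X_k,Z_k,Y_k,u^N_k)$, $H_k=(X_k,Z_k,Y_k,u_k)$. *)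

theory Defs
  imports "HOL-Probability.Probability"
begin

definition C2b :: "(real \<Rightarrow> real) \<Rightarrow> bool" where
  "C2b g \<longleftrightarrow>
     (\<forall>x. g field_differentiable at x) \<and> (\<forall>x. deriv g field_differentiable at x) \<and>
     continuous_on UNIV (deriv (deriv g)) \<and>
     bounded (range g) \<and> bounded (range (deriv g)) \<and> bounded (range (deriv (deriv g)))"

definition couplings :: "'s::metric_space measure \<Rightarrow> 's measure \<Rightarrow> ('s \<times> 's) measure set" where
  "couplings \<mu> \<nu> = {\<pi>. sets \<pi> = sets (borel \<Otimes>\<^sub>M borel) \<and>
     distr \<pi> borel fst = \<mu> \<and> distr \<pi> borel snd = \<nu>}"

definition ennsqrt :: "ennreal \<Rightarrow> ennreal" where
  "ennsqrt t = (if t = \<infinity> then \<infinity> else ennreal (sqrt (enn2real t)))"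

text \<open>Extended-valued, so that no second moment assumption is needed to state it; on a product of
  Euclidean spaces \<^const>\<open>dist\<close> is the Euclidean distance of the concatenated vectors.\<close>

definition wasserstein2 :: "'s::metric_space measure \<Rightarrow> 's measure \<Rightarrow> ennreal" where
  "wasserstein2 \<mu> \<nu> =
     ennsqrt (INF \<pi>\<in>couplings \<mu> \<nu>. \<integral>\<^sup>+ p. ennreal ((dist (fst p) (snd p))\<^sup>2) \<partial>\<pi>)"

definition gen_events :: "'a measure \<Rightarrow> 'b measure \<Rightarrow> ('a \<Rightarrow> 'b) \<Rightarrow> 'a set set" where
  "gen_events M N X = {X -` A \<inter> space M | A. A \<in> sets N}"

text \<open>The library's \<^term>\<open>prob_space.indep_var\<close> only relates variables with values in the same
  type; this is its unfolding for two value types.\<close>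

definition indep_rv ::
  "'a measure \<Rightarrow> 'b measure \<Rightarrow> ('a \<Rightarrow> 'b) \<Rightarrow> 'c measure \<Rightarrow> ('a \<Rightarrow> 'c) \<Rightarrow> bool" where
  "indep_rv M N1 X1 N2 X2 \<longleftrightarrow>
     X1 \<in> measurable M N1 \<and> X2 \<in> measurable M N2 \<and>
     prob_space.indep_set M (gen_events M N1 X1) (gen_events M N2 X2)"

definition indep_rv3 ::
  "'a measure \<Rightarrow> 'b measure \<Rightarrow> ('a \<Rightarrow> 'b) \<Rightarrow> 'c measure \<Rightarrow> ('a \<Rightarrow> 'c) \<Rightarrow>
   'd measure \<Rightarrow> ('a \<Rightarrow> 'd) \<Rightarrow> bool" where
  "indep_rv3 M N1 X1 N2 X2 N3 X3 \<longleftrightarrow>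
     X1 \<in> measurable M N1 \<and> X2 \<in> measurable M N2 \<and> X3 \<in> measurable M N3 \<and>
     prob_space.indep_sets M
       (\<lambda>j. [gen_events M N1 X1, gen_events M N2 X2, gen_events M N3 X3] ! j) {..<3::nat}"

definition nat_filtration :: "'a measure \<Rightarrow> (nat \<Rightarrow> 'a \<Rightarrow> 's::topological_space) \<Rightarrow> nat \<Rightarrow> 'a measure"
  where "nat_filtration M S k = sigma (space M) (\<Union>j\<le>k. gen_events M borel (S j))"

definition markov_chain ::
  "'a measure \<Rightarrow> ('s::topological_space \<Rightarrow> 's measure) \<Rightarrow> (nat \<Rightarrow> 'a \<Rightarrow> 's) \<Rightarrow> bool" where
  "markov_chain M P S \<longleftrightarrow>
     P \<in> measurable borel (prob_algebra borel) \<and>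
     (\<forall>k. S k \<in> borel_measurable M) \<and>
     (\<forall>k. \<forall>A\<in>sets borel. AE \<omega> in M.
        real_cond_exp M (nat_filtration M S k) (\<lambda>\<omega>'. indicator A (S (Suc k) \<omega>')) \<omega>
          = measure (P (S k \<omega>)) A)"

text \<open>The training recursion along one realisation \<open>x\<close>, \<open>y\<close> of the data, with initial
  parameters \<open>c0\<close>, \<open>w0\<close>, \<open>b0\<close>. The components at time \<open>k\<close> are
  \<open>C\<^sub>k\<close>, \<open>W\<^sub>k\<close>, \<open>B\<^sub>k\<close> and the hidden states \<open>S\<^sub>k\<close>, as functions of the unit, whose index
  ranges over \<open>{1..N}\<close>. Note that the update of \<open>B\<close> uses both the old hidden states (in the
  product) and the new ones (through \<open>yhat\<close>).\<close>

record 'd rnn_state =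
  Cpar :: "nat \<Rightarrow> real"
  Wpar :: "nat \<Rightarrow> real ^ 'd"
  Bpar :: "nat \<Rightarrow> real"
  Shid :: "nat \<Rightarrow> real"

definition rnn_step ::
  "(real \<Rightarrow> real) \<Rightarrow> (real \<Rightarrow> real) \<Rightarrow> real \<Rightarrow> real \<Rightarrow> nat \<Rightarrow>
   real ^ 'd::finite \<Rightarrow> real \<Rightarrow> 'd rnn_state \<Rightarrow> 'd rnn_state" where
  "rnn_step \<sigma> \<psi> \<alpha> \<beta> N xk yk s =
    (let
       arg = (\<lambda>i. Wpar s i \<bullet> xk + (1 / real N) * (\<Sum>j=1..N. Bpar s j * Shid s j));
       Snew = (\<lambda>i. \<sigma> (arg i));
       dS = (\<lambda>i. deriv \<sigma> (arg i));
       yhat = real N powr (- \<beta>) * (\<Sum>i=1..N. Cpar s i * Snew i);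
       err = \<psi> yhat - yk
     in \<lparr> Cpar = (\<lambda>i. Cpar s i - \<alpha> / real N powr (2 - \<beta>) * err * Snew i),
          Wpar = (\<lambda>i. Wpar s i - (\<alpha> * Cpar s i / real N powr (2 - \<beta>) * err * dS i) *\<^sub>R xk),
          Bpar = (\<lambda>i. Bpar s i - \<alpha> / real N powr (3 - \<beta>) * err
                        * (\<Sum>l=1..N. Cpar s l * Shid s l * dS l)),
          Shid = Snew \<rparr>)"

primrec rnn_train ::
  "(real \<Rightarrow> real) \<Rightarrow> (real \<Rightarrow> real) \<Rightarrow> real \<Rightarrow> real \<Rightarrow> nat \<Rightarrow>
   (nat \<Rightarrow> real ^ 'd::finite) \<Rightarrow> (nat \<Rightarrow> real) \<Rightarrow>
   (nat \<Rightarrow> real) \<Rightarrow> (nat \<Rightarrow> real ^ 'd) \<Rightarrow> (nat \<Rightarrow> real) \<Rightarrow> nat \<Rightarrow> 'd rnn_state" where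
  "rnn_train \<sigma> \<psi> \<alpha> \<beta> N x y c0 w0 b0 0 = \<lparr> Cpar = c0, Wpar = w0, Bpar = b0, Shid = (\<lambda>i. 0) \<rparr>"
| "rnn_train \<sigma> \<psi> \<alpha> \<beta> N x y c0 w0 b0 (Suc k) =
     rnn_step \<sigma> \<psi> \<alpha> \<beta> N (x k) (y k) (rnn_train \<sigma> \<psi> \<alpha> \<beta> N x y c0 w0 b0 k)"

text \<open>The time shift is part of the definition: at time \<open>k\<close> the outer weights \<open>B\<close> are those of
  time \<open>k\<close>, the inner weights \<open>W\<close> those of time \<open>k - 1\<close>.\<close>

primrec trained_memory ::
  "(real \<Rightarrow> real) \<Rightarrow> nat \<Rightarrow> (nat \<Rightarrow> 'd::finite rnn_state) \<Rightarrow> (nat \<Rightarrow> real ^ 'd) \<Rightarrow> nat \<Rightarrow> real" where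
  "trained_memory \<sigma> N st x 0 = 0"
| "trained_memory \<sigma> N st x (Suc k) =
     (1 / real N) * (\<Sum>j=1..N. Bpar (st (Suc k)) j *
        \<sigma> (Wpar (st k) j \<bullet> x k + trained_memory \<sigma> N st x k))"

primrec untrained_memory ::
  "(real \<Rightarrow> real) \<Rightarrow> nat \<Rightarrow> (nat \<Rightarrow> real ^ 'd::finite) \<Rightarrow> (nat \<Rightarrow> real) \<Rightarrow>
   (nat \<Rightarrow> real ^ 'd) \<Rightarrow> nat \<Rightarrow> real" where
  "untrained_memory \<sigma> N w0 b0 x 0 = 0"
| "untrained_memory \<sigma> N w0 b0 x (Suc k) =
     (1 / real N) * (\<Sum>j=1..N. b0 j * \<sigma> (w0 j \<bullet> x k + untrained_memory \<sigma> N w0 b0 x k))"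

primrec mean_field_memory ::
  "(real \<Rightarrow> real) \<Rightarrow> real \<Rightarrow> (real ^ 'd::finite) measure \<Rightarrow> (nat \<Rightarrow> real ^ 'd) \<Rightarrow> nat \<Rightarrow> real" where
  "mean_field_memory \<sigma> \<mu>b lamW x 0 = 0"
| "mean_field_memory \<sigma> \<mu>b lamW x (Suc k) =
     \<mu>b * (\<integral>w. \<sigma> (w \<bullet> x k + mean_field_memory \<sigma> \<mu>b lamW x k) \<partial>lamW)"

end

theory Submission
  imports Defs
begin

text \<open>Over at most \<open>N T\<close> training steps, each of size \<open>O(N\<^sup>\<beta>\<^sup>+\<^sup>\<gamma>\<^sup>-\<^sup>2)\<close>, the parameters
  \<open>W\<close> and \<open>B\<close> move by at most \<open>O(N\<^sup>\<beta>\<^sup>+\<^sup>\<gamma>\<^sup>-\<^sup>1)\<close>. The memory map contracts with factor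
  \<open>K\<^sub>b C\<^sub>\<sigma>\<^sub>' < 1\<close>, so this perturbation does not accumulate in the memory. For the second bound,
  the one-step error splits into the propagated error, whose square contributes a factor
  \<open>2 K\<^sub>b\<^sup>2 C\<^sub>\<sigma>\<^sub>'\<^sup>2 < 1\<close>, and an average of \<open>N\<close> terms that are i.i.d., centred and bounded once the
  data are frozen, whose second moment is therefore \<open>O(1/N)\<close>.\<close>

text \<open>\<open>D / (1 - q)\<close> is the fixed point of \<open>t \<mapsto> q * t + D\<close>,
  and this map is monotone because \<open>q \<ge> 0\<close>, so a sequence that starts below the
  fixed point stays below it. The recursion is required only before the horizon \<open>K\<close>,
  since the trained parameters are controlled only over a finite training time.\<close>

lemma affine_recursion_bound:
  fixes e :: "nat \<Rightarrow> real"
  assumes "e 0 \<le> 0" and q: "0 \<le> q" "q < 1" and D: "0 \<le> D"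
    and step: "\<And>k. k < K \<Longrightarrow> e (Suc k) \<le> q * e k + D"
  shows "k \<le> K \<Longrightarrow> e k \<le> D / (1 - q)"
proof (induction k)
  case 0
  have "0 \<le> D / (1 - q)" using q D by simp
  then show ?case using assms(1) by linarith
next
  case (Suc k)
  have "e (Suc k) \<le> q * e k + D" using step Suc.prems by simp
  also have "\<dots> \<le> q * (D / (1 - q)) + D"
    using Suc q(1) by (intro add_right_mono mult_left_mono) auto
  also have "\<dots> = D / (1 - q)" using q by (simp add: field_simps)
  finally show ?case .
qed

lemma norm_increments_bound:
  fixes a :: "nat \<Rightarrow> 'b::real_normed_vector"
  assumes "\<And>j. j < k \<Longrightarrow> norm (a (Suc j) - a j) \<le> h"
  shows "norm (a k - a 0) \<le> real k * h"
proof -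
  have "norm (a k - a 0) = norm (\<Sum>j<k. a (Suc j) - a j)"
    by (simp add: sum_lessThan_telescope)
  also have "\<dots> \<le> (\<Sum>j<k. h)"
    by (intro sum_norm_le) (auto intro: assms)
  finally show ?thesis by simp
qed

text \<open>The Lipschitz constant is the supremum of the absolute derivative itself and not just
  some bound for it, because the smallness condition of the theorem concerns this supremum.
  Boundedness of the derivative makes \<open>SUP\<close> a genuine upper bound; the mean value
  inequality does the rest.\<close>

lemma C2bE:
  assumes "C2b g"
  obtains S where "0 \<le> S" "\<And>x. \<bar>g x\<bar> \<le> S"
    "\<And>x. \<bar>deriv g x\<bar> \<le> (SUP x. \<bar>deriv g x\<bar>)"
    "\<And>x y. \<bar>g x - g y\<bar> \<le> (SUP x. \<bar>deriv g x\<bar>) * \<bar>x - y\<bar>"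
    "g \<in> borel_measurable borel"
proof -
  have diff: "g field_differentiable at x" for x using assms by (simp add: C2b_def)
  obtain S where S: "\<And>x. \<bar>g x\<bar> \<le> S" using assms by (auto simp: C2b_def bounded_iff)
  obtain S' where S': "\<And>x. \<bar>deriv g x\<bar> \<le> S'" using assms by (auto simp: C2b_def bounded_iff)
  have d: "\<bar>deriv g x\<bar> \<le> (SUP x. \<bar>deriv g x\<bar>)" for x
    by (rule cSUP_upper) (auto intro!: bdd_aboveI[of _ S'] S')
  have lip: "\<bar>g x - g y\<bar> \<le> (SUP x. \<bar>deriv g x\<bar>) * \<bar>x - y\<bar>" for x y
    using field_differentiable_bound[of UNIV g "deriv g" "SUP x. \<bar>deriv g x\<bar>" x y]
      diff d by (simp add: field_differentiable_derivI)
  have "continuous_on UNIV g"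
    using diff by (auto intro!: continuous_at_imp_continuous_on field_differentiable_imp_continuous_at)
  then have "g \<in> borel_measurable borel" by (rule borel_measurable_continuous_onI)
  moreover have "0 \<le> S" using S[of 0] by linarith
  ultimately show ?thesis using S d lip that by blast
qed

lemma average_bound:
  fixes a :: "nat \<Rightarrow> real"
  assumes "N \<ge> 1" "\<And>j. j \<in> {1..N} \<Longrightarrow> \<bar>a j\<bar> \<le> c"
  shows "\<bar>1 / real N * (\<Sum>j=1..N. a j)\<bar> \<le> c"
proof -
  have "\<bar>\<Sum>j=1..N. a j\<bar> \<le> (\<Sum>j=1..N. c)"
    by (rule order_trans[OF sum_abs sum_mono]) (rule assms(2))
  then show ?thesis using assms(1) by (simp add: abs_mult field_simps)
qed

text \<open>A pathwise estimate: one update moves a parameter by at most a constant times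
  \<open>N powr (\<beta> + \<gamma> - 2)\<close>, and there are at most \<open>N * T\<close>
  updates. The increments of W and B carry the output weights C as a factor, so C is bounded first;
  \<open>KC\<close> is its initial bound plus its largest possible drift
  \<open>R * S\<close>.\<close>

lemma rnn_train_deviation:
  fixes x :: "nat \<Rightarrow> real ^ 'd::finite" and \<sigma> \<psi> :: "real \<Rightarrow> real"
    and \<alpha> \<beta> \<gamma> T S Cs Cy Cx Kc :: real
    and y c0 b0 :: "nat \<Rightarrow> real" and w0 :: "nat \<Rightarrow> real ^ 'd" and N k i :: nat
  defines "s \<equiv> rnn_train \<sigma> \<psi> \<alpha> \<beta> N x y c0 w0 b0"
  assumes N: "N \<ge> 1" and \<alpha>: "0 \<le> \<alpha>" and \<gamma>: "0 \<le> \<gamma>" "\<beta> + \<gamma> \<le> 1" and T: "0 \<le> T"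
    and S: "0 \<le> S" "\<And>z. \<bar>\<sigma> z\<bar> \<le> S"
    and Cs: "\<And>z. \<bar>deriv \<sigma> z\<bar> \<le> Cs"
    and \<psi>: "\<And>z. \<bar>\<psi> z\<bar> \<le> 2 * real N powr \<gamma>"
    and y: "\<And>k. \<bar>y k\<bar> \<le> Cy" and x: "\<And>k. norm (x k) \<le> Cx"
    and c0: "\<And>i. i \<in> {1..N} \<Longrightarrow> \<bar>c0 i\<bar> \<le> Kc"
  defines "R \<equiv> T * \<alpha> * (2 + Cy)"
  defines "KC \<equiv> Kc + R * S"
  defines "\<delta> \<equiv> real N powr (\<beta> + \<gamma> - 1)"
  assumes k: "real k \<le> real N * T" and i: "i \<in> {1..N}"
  shows "norm (Wpar (s k) i - w0 i) \<le> R * KC * Cs * Cx * \<delta>"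
    and "\<bar>Bpar (s k) i - b0 i\<bar> \<le> R * KC * S * Cs * \<delta>"
proof -
  define E where "E = 2 + Cy"
  have "0 \<le> Cy" using y[of 0] by linarith
  then have E0: "0 \<le> E" by (simp add: E_def)
  have Cs0: "0 \<le> Cs" using Cs[of 0] by linarith
  have Cx0: "0 \<le> Cx" using x[of 0] norm_ge_zero[of "x 0"] by linarith
  have Kc0: "0 \<le> Kc" using c0[OF i] by linarith
  have R0: "0 \<le> R" unfolding R_def using T \<alpha> \<open>0 \<le> Cy\<close> by simp
  have KC0: "0 \<le> KC" unfolding KC_def using Kc0 R0 S by simp
  define Ng where "Ng = real N powr \<gamma>"
  define Nb where "Nb = real N powr (2 - \<beta>)"
  have Ng1: "1 \<le> Ng" unfolding Ng_def using N \<gamma> by (intro ge_one_powr_ge_zero) auto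
  have Nb0: "0 < Nb" unfolding Nb_def using N by simp
  \<comment> \<open>\<open>\<rho>\<close> bounds \<open>\<alpha> / Nb * err j\<close>, the factor
    shared by all three updates. Over \<open>N * T\<close> steps it accumulates to
    \<open>R * \<delta>\<close>, because \<open>N * Ng / Nb = \<delta>\<close>.\<close>
  define \<rho> where "\<rho> = \<alpha> * E * Ng / Nb"
  have \<rho>0: "0 \<le> \<rho>" unfolding \<rho>_def using \<alpha> E0 Ng1 Nb0 by simp
  have N\<rho>: "real N * T * \<rho> = R * \<delta>"
  proof -
    have "\<delta> = real N powr 1 * Ng / Nb"
      unfolding \<delta>_def Ng_def Nb_def using N
      by (simp only: powr_add[symmetric] powr_diff[symmetric]) (simp add: algebra_simps)
    then show ?thesis using N by (simp add: \<rho>_def R_def E_def)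
  qed
  have \<delta>1: "\<delta> \<le> 1" unfolding \<delta>_def using N \<gamma> powr_mono[of "\<beta>+\<gamma>-1" 0 "real N"] by simp
  have \<delta>0: "0 \<le> \<delta>" unfolding \<delta>_def by simp
  \<comment> \<open>Splitting off one factor \<open>N\<close> turns the sum over units in the update
    of B into an average, which is bounded uniformly in \<open>N\<close>.\<close>
  have N3: "real N powr (3 - \<beta>) = real N * Nb"
  proof -
    have "real N powr (3 - \<beta>) = real N powr (1 + (2 - \<beta>))" by (simp add: algebra_simps)
    also have "\<dots> = real N powr 1 * Nb" unfolding Nb_def by (rule powr_add)
    finally show ?thesis using N by simp
  qed
  define arg where "arg j i = Wpar (s j) i \<bullet> x j + (1 / real N) * (\<Sum>l=1..N. Bpar (s j) l * Shid (s j) l)" for j i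
  define err where "err j = \<psi> (real N powr (- \<beta>) * (\<Sum>i=1..N. Cpar (s j) i * \<sigma> (arg j i))) - y j" for j
  have sC: "Cpar (s (Suc j)) i = Cpar (s j) i - \<alpha> / Nb * err j * \<sigma> (arg j i)"
    and sW: "Wpar (s (Suc j)) i = Wpar (s j) i - (\<alpha> * Cpar (s j) i / Nb * err j * deriv \<sigma> (arg j i)) *\<^sub>R x j"
    and sB: "Bpar (s (Suc j)) i = Bpar (s j) i - \<alpha> / (real N * Nb) * err j *
               (\<Sum>l=1..N. Cpar (s j) l * Shid (s j) l * deriv \<sigma> (arg j l))"
    and sS: "Shid (s (Suc j)) i = \<sigma> (arg j i)" for j i
    unfolding s_def rnn_train.simps rnn_step_def Let_def N3[symmetric]
    by (simp_all add: arg_def err_def s_def Nb_def)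
  have s0: "Cpar (s 0) i = c0 i" "Wpar (s 0) i = w0 i" "Bpar (s 0) i = b0 i" "Shid (s 0) i = 0" for i
    by (simp_all add: s_def)
  have Sh: "\<bar>Shid (s j) i\<bar> \<le> S" for j i
    by (cases j) (simp_all add: s0 sS S)
  \<comment> \<open>Clipping bounds the prediction by \<open>2 * Ng\<close>; since
    \<open>Ng \<ge> 1\<close>, the bound \<open>Cy\<close> on the data is absorbed into the same
    power of \<open>N\<close>.\<close>
  have err: "\<bar>err j\<bar> \<le> E * Ng" for j
  proof -
    have "\<bar>err j\<bar> \<le> 2 * Ng + Cy"
      unfolding err_def Ng_def
      by (rule order_trans[OF abs_triangle_ineq4 add_mono[OF \<psi> y]])
    also have "\<dots> \<le> 2 * Ng + Cy * Ng" using mult_left_mono[OF Ng1 \<open>0 \<le> Cy\<close>] by simp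
    finally show ?thesis by (simp add: E_def algebra_simps)
  qed
  have aerr: "\<bar>\<alpha> / Nb * err j\<bar> \<le> \<rho>" for j
    using mult_left_mono[OF err[of j], of "\<alpha> / Nb"] \<alpha> Nb0 by (simp add: abs_mult \<rho>_def mult.assoc)
  have time: "real j * (\<rho> * c) \<le> R * c * \<delta>" if "0 \<le> c" "real j \<le> real N * T" for j c
  proof -
    have "real j * (\<rho> * c) \<le> (real N * T) * (\<rho> * c)"
      using that \<rho>0 by (intro mult_right_mono) auto
    also have "\<dots> = R * c * \<delta>" using N\<rho> by (simp add: algebra_simps)
    finally show ?thesis .
  qed
  \<comment> \<open>The increments of C do not involve C except through the clipped error, so no
    Gronwall argument is needed. The drift is at most \<open>R * S * \<delta>\<close>, and
    \<open>\<delta> \<le> 1\<close> by \<open>\<beta> + \<gamma> \<le> 1\<close>.\<close>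
  have C: "\<bar>Cpar (s j) i\<bar> \<le> KC" if j: "real j \<le> real N * T" and i: "i \<in> {1..N}" for j i
  proof -
    have "\<bar>Cpar (s (Suc m)) i - Cpar (s m) i\<bar> \<le> \<rho> * S" for m
      using mult_mono[OF aerr[of m] S(2)[of "arg m i"]] \<rho>0 by (simp add: sC abs_mult)
    then have "\<bar>Cpar (s j) i - c0 i\<bar> \<le> real j * (\<rho> * S)"
      using norm_increments_bound[of j "\<lambda>m. Cpar (s m) i" "\<rho> * S"] by (simp add: s0)
    also have "\<dots> \<le> R * S * \<delta>" by (rule time[OF S(1) j])
    also have "\<dots> \<le> R * S * 1" using \<delta>1 R0 S by (intro mult_left_mono) auto
    finally show ?thesis using c0[OF i] by (simp add: KC_def)
  qed
  have before: "real j \<le> real N * T" if "j < k" for j using that k by linarith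
  have "norm (Wpar (s (Suc j)) i - Wpar (s j) i) \<le> \<rho> * (KC * Cs * Cx)" if "j < k" for j
  proof -
    have "norm (Wpar (s (Suc j)) i - Wpar (s j) i)
        = \<bar>\<alpha> / Nb * err j\<bar> * (\<bar>Cpar (s j) i\<bar> * \<bar>deriv \<sigma> (arg j i)\<bar> * norm (x j))"
      by (simp add: sW abs_mult)
    also have "\<dots> \<le> \<rho> * (KC * Cs * Cx)"
      using aerr C[OF before[OF that] i] Cs x \<rho>0 KC0 Cs0 Cx0
      by (intro mult_mono) auto
    finally show ?thesis .
  qed
  from norm_increments_bound[of k "\<lambda>m. Wpar (s m) i", OF this]
  have "norm (Wpar (s k) i - w0 i) \<le> real k * (\<rho> * (KC * Cs * Cx))" by (simp add: s0)
  also have "\<dots> \<le> R * (KC * Cs * Cx) * \<delta>" using KC0 Cs0 Cx0 by (intro time k) auto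
  finally show "norm (Wpar (s k) i - w0 i) \<le> R * KC * Cs * Cx * \<delta>" by (simp add: mult.assoc)
  have "norm (Bpar (s (Suc j)) i - Bpar (s j) i) \<le> \<rho> * (KC * S * Cs)" if "j < k" for j
  proof -
    have "\<bar>1 / real N * (\<Sum>l=1..N. Cpar (s j) l * Shid (s j) l * deriv \<sigma> (arg j l))\<bar> \<le> KC * S * Cs"
      using C[OF before[OF that]] Sh Cs KC0 S(1) Cs0
      by (intro average_bound N) (auto simp: abs_mult intro!: mult_mono)
    then have "\<bar>\<alpha> / Nb * err j\<bar> * \<bar>1 / real N * (\<Sum>l=1..N. Cpar (s j) l * Shid (s j) l * deriv \<sigma> (arg j l))\<bar>
       \<le> \<rho> * (KC * S * Cs)"
      using aerr \<rho>0 by (intro mult_mono) auto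
    then show ?thesis by (simp add: sB abs_mult mult_ac)
  qed
  from norm_increments_bound[of k "\<lambda>m. Bpar (s m) i", OF this]
  have "\<bar>Bpar (s k) i - b0 i\<bar> \<le> real k * (\<rho> * (KC * S * Cs))" by (simp add: s0)
  also have "\<dots> \<le> R * (KC * S * Cs) * \<delta>" using KC0 Cs0 S by (intro time k) auto
  finally show "\<bar>Bpar (s k) i - b0 i\<bar> \<le> R * KC * S * Cs * \<delta>" by (simp add: mult.assoc)
qed

text \<open>The one-step error is a fresh perturbation coming from the moved weights plus the old
  error multiplied by \<open>Kb * Cs < 1\<close>; the geometric series then gives a bound free of
  the number of steps. A memory step pairs B at time \<open>Suc k\<close> with W at time
  \<open>k\<close>, so both deviations are controlled up to and including \<open>K\<close>.\<close>

lemma trained_untrained_memory_bound: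
  fixes x :: "nat \<Rightarrow> real ^ 'd::finite"
  assumes N: "N \<ge> 1" and S: "0 \<le> S" "\<And>z. \<bar>\<sigma> z\<bar> \<le> S"
    and lip: "\<And>z z'. \<bar>\<sigma> z - \<sigma> z'\<bar> \<le> Cs * \<bar>z - z'\<bar>"
    and x: "\<And>k. norm (x k) \<le> Cx"
    and b0: "\<And>i. i \<in> {1..N} \<Longrightarrow> \<bar>b0 i\<bar> \<le> Kb"
    and q: "Kb * Cs < 1"
    and W: "\<And>k i. k \<le> K \<Longrightarrow> i \<in> {1..N} \<Longrightarrow> norm (Wpar (s k) i - w0 i) \<le> Dw"
    and B: "\<And>k i. k \<le> K \<Longrightarrow> i \<in> {1..N} \<Longrightarrow> \<bar>Bpar (s k) i - b0 i\<bar> \<le> Db"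
  shows "\<bar>trained_memory \<sigma> N s x K - untrained_memory \<sigma> N w0 b0 x K\<bar>
    \<le> (Db * S + Kb * Cs * Cx * Dw) / (1 - Kb * Cs)"
proof -
  define e where "e k = \<bar>trained_memory \<sigma> N s x k - untrained_memory \<sigma> N w0 b0 x k\<bar>" for k
  have one: "1 \<in> {1..N}" using N by simp
  have Kb0: "0 \<le> Kb" using b0[OF one] by linarith
  have Cs0: "0 \<le> Cs" using order_trans[OF abs_ge_zero lip[of 1 0]] by simp
  have Cx0: "0 \<le> Cx" using x[of 0] norm_ge_zero[of "x 0"] by linarith
  have Dw0: "0 \<le> Dw" using W[of 0 1] one norm_ge_zero[of "Wpar (s 0) 1 - w0 1"] by linarith
  have Db0: "0 \<le> Db" using B[of 0 1] one by linarith
  have step: "e (Suc k) \<le> (Kb * Cs) * e k + (Db * S + Kb * Cs * Cx * Dw)" if k: "k < K" for k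
  proof -
    define p where "p = trained_memory \<sigma> N s x k"
    define r where "r = untrained_memory \<sigma> N w0 b0 x k"
    have "e (Suc k) = \<bar>1 / real N * (\<Sum>j=1..N. Bpar (s (Suc k)) j * \<sigma> (Wpar (s k) j \<bullet> x k + p)
                               - b0 j * \<sigma> (w0 j \<bullet> x k + r))\<bar>"
      by (simp add: e_def p_def r_def sum_subtractf right_diff_distrib)
    also have "\<dots> \<le> Db * S + Kb * (Cs * (Dw * Cx + e k))"
    proof (rule average_bound[OF N])
      fix j assume j: "j \<in> {1..N}"
      let ?a = "Wpar (s k) j \<bullet> x k + p" and ?b = "w0 j \<bullet> x k + r"
      have "\<bar>?a - ?b\<bar> = \<bar>(Wpar (s k) j - w0 j) \<bullet> x k + (p - r)\<bar>" by (simp add: inner_diff_left)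
      also have "\<dots> \<le> \<bar>(Wpar (s k) j - w0 j) \<bullet> x k\<bar> + e k"
        unfolding e_def p_def r_def by linarith
      also have "\<bar>(Wpar (s k) j - w0 j) \<bullet> x k\<bar> \<le> norm (Wpar (s k) j - w0 j) * norm (x k)"
        by (rule Cauchy_Schwarz_ineq2)
      also have "\<dots> \<le> Dw * Cx" using W[of k j] k j x Dw0 by (intro mult_mono) auto
      finally have ab: "\<bar>?a - ?b\<bar> \<le> Dw * Cx + e k" by simp
      \<comment> \<open>The splitting puts the untrained weight \<open>b0 j\<close> in front of the
        difference of activations. The contraction factor is therefore exactly
        \<open>Kb * Cs\<close>, whereas the trained weight would enlarge it by
        \<open>Db * Cs\<close>.\<close>
      have "\<bar>Bpar (s (Suc k)) j * \<sigma> ?a - b0 j * \<sigma> ?b\<bar>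
          = \<bar>(Bpar (s (Suc k)) j - b0 j) * \<sigma> ?a + b0 j * (\<sigma> ?a - \<sigma> ?b)\<bar>" by (simp add: algebra_simps)
      also have "\<dots> \<le> \<bar>Bpar (s (Suc k)) j - b0 j\<bar> * \<bar>\<sigma> ?a\<bar> + \<bar>b0 j\<bar> * \<bar>\<sigma> ?a - \<sigma> ?b\<bar>"
        by (rule order_trans[OF abs_triangle_ineq]) (simp add: abs_mult)
      also have "\<dots> \<le> Db * S + Kb * (Cs * (Dw * Cx + e k))"
        using B[of "Suc k" j] k j S b0[OF j] Db0 Kb0 order_trans[OF lip mult_left_mono[OF ab Cs0]]
        by (intro add_mono mult_mono) auto
      finally show "\<bar>Bpar (s (Suc k)) j * \<sigma> ?a - b0 j * \<sigma> ?b\<bar> \<le> Db * S + Kb * (Cs * (Dw * Cx + e k))" .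
    qed
    finally show ?thesis by (simp add: algebra_simps)
  qed
  have "e K \<le> (Db * S + Kb * Cs * Cx * Dw) / (1 - Kb * Cs)"
    using Kb0 Cs0 Cx0 Dw0 Db0 S(1) q step
    by (intro affine_recursion_bound[where K=K]) (auto simp: e_def)
  then show ?thesis by (simp add: e_def)
qed

context prob_space begin

lemma indep_rvI:
  assumes "random_variable N1 X1" "random_variable N2 X2"
    and "\<And>A B. A \<in> sets N1 \<Longrightarrow> B \<in> sets N2 \<Longrightarrow>
      prob ((X1 -` A \<inter> space M) \<inter> (X2 -` B \<inter> space M)) = prob (X1 -` A \<inter> space M) * prob (X2 -` B \<inter> space M)"
  shows "indep_rv M N1 X1 N2 X2"
  using assms unfolding indep_rv_def
  by (auto simp: gen_events_def indep_sets2_eq measurable_sets)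

lemma indep_rvD:
  assumes "indep_rv M N1 X1 N2 X2"
  shows "random_variable N1 X1" "random_variable N2 X2"
    and "\<And>A B. A \<in> sets N1 \<Longrightarrow> B \<in> sets N2 \<Longrightarrow>
      prob ((X1 -` A \<inter> space M) \<inter> (X2 -` B \<inter> space M)) = prob (X1 -` A \<inter> space M) * prob (X2 -` B \<inter> space M)"
  using assms unfolding indep_rv_def
  by (auto simp: gen_events_def intro!: indep_setD)

lemma indep_rv_compose:
  assumes ind: "indep_rv M N1 X1 N2 X2"
    and f: "f \<in> measurable N1 N1'" and g: "g \<in> measurable N2 N2'"
  shows "indep_rv M N1' (\<lambda>\<omega>. f (X1 \<omega>)) N2' (\<lambda>\<omega>. g (X2 \<omega>))"
proof (rule indep_rvI)
  note X = indep_rvD(1,2)[OF ind]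
  show "random_variable N1' (\<lambda>\<omega>. f (X1 \<omega>))" "random_variable N2' (\<lambda>\<omega>. g (X2 \<omega>))"
    using X f g by (auto intro: measurable_compose)
  fix A B assume AB: "A \<in> sets N1'" "B \<in> sets N2'"
  have "(\<lambda>\<omega>. f (X1 \<omega>)) -` A \<inter> space M = X1 -` (f -` A \<inter> space N1) \<inter> space M"
       "(\<lambda>\<omega>. g (X2 \<omega>)) -` B \<inter> space M = X2 -` (g -` B \<inter> space N2) \<inter> space M"
    using X[THEN measurable_space] by auto
  then show "prob (((\<lambda>\<omega>. f (X1 \<omega>)) -` A \<inter> space M) \<inter> ((\<lambda>\<omega>. g (X2 \<omega>)) -` B \<inter> space M)) =
     prob ((\<lambda>\<omega>. f (X1 \<omega>)) -` A \<inter> space M) * prob ((\<lambda>\<omega>. g (X2 \<omega>)) -` B \<inter> space M)"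
    using indep_rvD(3)[OF ind measurable_sets[OF f AB(1)] measurable_sets[OF g AB(2)]] by simp
qed

text \<open>A product of sigma-finite measures is determined by its values on rectangles, and there
  the product formula for independent events applies.\<close>

lemma indep_rv_distr_pair:
  assumes ind: "indep_rv M N1 X1 N2 X2"
  shows "distr M N1 X1 \<Otimes>\<^sub>M distr M N2 X2 = distr M (N1 \<Otimes>\<^sub>M N2) (\<lambda>\<omega>. (X1 \<omega>, X2 \<omega>))"
proof (rule pair_measure_eqI)
  note X[measurable] = indep_rvD(1,2)[OF ind]
  show "sigma_finite_measure (distr M N1 X1)" "sigma_finite_measure (distr M N2 X2)"
    by (auto intro!: prob_space_distr prob_space_imp_sigma_finite)
  fix A B assume "A \<in> sets (distr M N1 X1)" "B \<in> sets (distr M N2 X2)"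
  then have AB[measurable]: "A \<in> sets N1" "B \<in> sets N2" by auto
  have "(\<lambda>\<omega>. (X1 \<omega>, X2 \<omega>)) -` (A \<times> B) \<inter> space M = (X1 -` A \<inter> space M) \<inter> (X2 -` B \<inter> space M)"
    by auto
  then show "emeasure (distr M N1 X1) A * emeasure (distr M N2 X2) B =
      emeasure (distr M (N1 \<Otimes>\<^sub>M N2) (\<lambda>\<omega>. (X1 \<omega>, X2 \<omega>))) (A \<times> B)"
    using indep_rvD(3)[OF ind AB]
    by (simp add: emeasure_distr emeasure_eq_measure ennreal_mult[symmetric])
qed simp

text \<open>Tonelli for the joint law: \<open>X2\<close> is frozen while \<open>X1\<close> is
  averaged over a separate sample point. This replaces conditioning on \<open>X2\<close>.\<close>

lemma indep_rv_nn_integral: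
  assumes ind: "indep_rv M N1 X1 N2 X2" and F[measurable]: "F \<in> borel_measurable (N1 \<Otimes>\<^sub>M N2)"
  shows "(\<integral>\<^sup>+\<omega>. F (X1 \<omega>, X2 \<omega>) \<partial>M) = (\<integral>\<^sup>+\<omega>. (\<integral>\<^sup>+\<omega>'. F (X1 \<omega>', X2 \<omega>) \<partial>M) \<partial>M)"
proof -
  note X[measurable] = indep_rvD(1,2)[OF ind]
  interpret D1: prob_space "distr M N1 X1" by (rule prob_space_distr) fact
  interpret D2: prob_space "distr M N2 X2" by (rule prob_space_distr) fact
  interpret pair_sigma_finite "distr M N1 X1" "distr M N2 X2" ..
  have "(\<integral>\<^sup>+\<omega>. F (X1 \<omega>, X2 \<omega>) \<partial>M) = (\<integral>\<^sup>+p. F p \<partial>(distr M N1 X1 \<Otimes>\<^sub>M distr M N2 X2))"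
    unfolding indep_rv_distr_pair[OF ind] by (simp add: nn_integral_distr)
  also have "\<dots> = (\<integral>\<^sup>+d. (\<integral>\<^sup>+a. F (a, d) \<partial>distr M N1 X1) \<partial>distr M N2 X2)"
    by (rule nn_integral_snd[symmetric]) measurable
  also have "\<dots> = (\<integral>\<^sup>+\<omega>. (\<integral>\<^sup>+a. F (a, X2 \<omega>) \<partial>distr M N1 X1) \<partial>M)"
    by (rule nn_integral_distr) (measurable)
  also have "\<dots> = (\<integral>\<^sup>+\<omega>. (\<integral>\<^sup>+\<omega>'. F (X1 \<omega>', X2 \<omega>) \<partial>M) \<partial>M)"
    using X(2)[THEN measurable_space]
    by (intro nn_integral_cong nn_integral_distr) measurable
  finally show ?thesis .
qed

text \<open>Here both variables are real, so the product form of the joint law gives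
  \<open>indep_var\<close>, for which expectations multiply.\<close>

lemma indep_rv_expectation_mult:
  fixes X1 X2 :: "'a \<Rightarrow> real"
  assumes "indep_rv M borel X1 borel X2" "integrable M X1" "integrable M X2"
  shows "expectation (\<lambda>\<omega>. X1 \<omega> * X2 \<omega>) = expectation X1 * expectation X2"
  using assms indep_rvD(1,2)[OF assms(1)] indep_rv_distr_pair[OF assms(1)]
  by (intro indep_var_lebesgue_integral) (auto simp: indep_var_distribution_eq)

lemma indep_rv3_imp_indep_rv:
  assumes "indep_rv3 M N1 X1 N2 X2 N3 X3"
  shows "indep_rv M N2 X2 N3 X3"
proof (rule indep_rvI)
  show "random_variable N2 X2" "random_variable N3 X3" using assms by (auto simp: indep_rv3_def)
  fix A B assume AB: "A \<in> sets N2" "B \<in> sets N3"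
  \<comment> \<open>The list is indexed from 0, so the second and third variables have indices 1 and
    2; the product formula is used for this subset of the three indices.\<close>
  define F where "F j = (if j = (1::nat) then X2 -` A \<inter> space M else X3 -` B \<inter> space M)" for j
  have "prob (\<Inter>j\<in>{1,2}. F j) = (\<Prod>j\<in>{1,2}. prob (F j))"
    using assms AB unfolding indep_rv3_def
    by (intro indep_setsD[where I="{..<3}" and F="\<lambda>j. [gen_events M N1 X1, gen_events M N2 X2, gen_events M N3 X3] ! j"])
       (auto simp: F_def gen_events_def)
  then show "prob ((X2 -` A \<inter> space M) \<inter> (X3 -` B \<inter> space M)) = prob (X2 -` A \<inter> space M) * prob (X3 -` B \<inter> space M)"
    by (simp add: F_def Int_commute)
qed

text \<open>In the expanded square the off-diagonal terms vanish by independence and centring. Only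
  \<open>card I\<close> diagonal terms remain, each at most \<open>c\<^sup>2\<close>.\<close>

lemma second_moment_indep_sum_le:
  fixes \<xi> :: "'i \<Rightarrow> 'a \<Rightarrow> real"
  assumes "finite I" and ind: "indep_vars (\<lambda>_. borel) \<xi> I"
    and mean: "\<And>i. i \<in> I \<Longrightarrow> expectation (\<xi> i) = 0"
    and bnd: "\<And>i. i \<in> I \<Longrightarrow> AE \<omega> in M. \<bar>\<xi> i \<omega>\<bar> \<le> c"
  shows "integrable M (\<lambda>\<omega>. (\<Sum>i\<in>I. \<xi> i \<omega>)\<^sup>2)"
    and "expectation (\<lambda>\<omega>. (\<Sum>i\<in>I. \<xi> i \<omega>)\<^sup>2) \<le> real (card I) * c\<^sup>2"
proof -
  have rv[measurable]: "\<xi> i \<in> borel_measurable M" if "i \<in> I" for i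
    using ind that by (auto simp: indep_vars_def)
  have int: "integrable M (\<xi> i)" if "i \<in> I" for i
    using bnd[OF that] that by (intro integrable_const_bound[where B=c]) auto
  have int2: "integrable M (\<lambda>\<omega>. \<xi> i \<omega> * \<xi> j \<omega>)" if "i \<in> I" "j \<in> I" for i j
  proof (rule integrable_const_bound[where B="c * c"])
    show "AE \<omega> in M. norm (\<xi> i \<omega> * \<xi> j \<omega>) \<le> c * c"
      using bnd[OF that(1)] bnd[OF that(2)] by eventually_elim (auto simp: abs_mult intro!: mult_mono)
  qed (use that in measurable)
  have E: "expectation (\<lambda>\<omega>. \<xi> i \<omega> * \<xi> j \<omega>) \<le> (if i = j then c\<^sup>2 else 0)" if "i \<in> I" "j \<in> I" for i j
  proof (cases "i = j")
    case True
    have "AE \<omega> in M. \<xi> i \<omega> * \<xi> j \<omega> \<le> c\<^sup>2"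
      using bnd[OF that(1)] unfolding True
      by eventually_elim (metis abs_le_square_iff abs_of_nonneg abs_ge_zero order_trans power2_eq_square)
    then show ?thesis using True integral_mono_AE[OF int2[OF that], of "\<lambda>_. c\<^sup>2"] prob_space by simp
  next
    case False
    have "expectation (\<lambda>\<omega>. \<Prod>l\<in>{i,j}. \<xi> l \<omega>) = (\<Prod>l\<in>{i,j}. expectation (\<xi> l))"
      using that int by (intro indep_vars_lebesgue_integral indep_vars_subset[OF ind]) auto
    then show ?thesis using False mean that by simp
  qed
  have sq: "(\<Sum>i\<in>I. \<xi> i \<omega>)\<^sup>2 = (\<Sum>i\<in>I. \<Sum>j\<in>I. \<xi> i \<omega> * \<xi> j \<omega>)" for \<omega>
    by (simp add: power2_eq_square sum_product)
  show "integrable M (\<lambda>\<omega>. (\<Sum>i\<in>I. \<xi> i \<omega>)\<^sup>2)"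
    unfolding sq by (intro Bochner_Integration.integrable_sum int2)
  have "expectation (\<lambda>\<omega>. (\<Sum>i\<in>I. \<xi> i \<omega>)\<^sup>2) = (\<Sum>i\<in>I. \<Sum>j\<in>I. expectation (\<lambda>\<omega>. \<xi> i \<omega> * \<xi> j \<omega>))"
    unfolding sq using int2 by (simp add: Bochner_Integration.integral_sum Bochner_Integration.integrable_sum)
  also have "\<dots> \<le> (\<Sum>i\<in>I. \<Sum>j\<in>I. if i = j then c\<^sup>2 else 0)"
    by (intro sum_mono E)
  also have "\<dots> = real (card I) * c\<^sup>2" using \<open>finite I\<close> by simp
  finally show "expectation (\<lambda>\<omega>. (\<Sum>i\<in>I. \<xi> i \<omega>)\<^sup>2) \<le> real (card I) * c\<^sup>2" .
qed

text \<open>The whole family \<open>\<theta>\<close> is independent of \<open>D\<close>, so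
  \<open>D\<close> may be frozen at a value \<open>d\<close>; then the
  \<open>G (\<theta> i \<omega>, d)\<close> are independent, centred and bounded. Centring and
  boundedness are asked for every \<open>d\<close> in the space, which makes the inner integral
  bounded at every sample point.\<close>

lemma conditional_second_moment_sum_le:
  assumes "finite I" and ind: "indep_vars (\<lambda>_. T) \<theta> I"
    and indD: "indep_rv M (\<Pi>\<^sub>M i\<in>I. T) (\<lambda>\<omega>. \<lambda>i\<in>I. \<theta> i \<omega>) Q D"
    and G[measurable]: "G \<in> borel_measurable (T \<Otimes>\<^sub>M Q)"
    and mean: "\<And>i d. i \<in> I \<Longrightarrow> d \<in> space Q \<Longrightarrow> expectation (\<lambda>\<omega>. G (\<theta> i \<omega>, d)) = 0"
    and bnd: "\<And>i d. i \<in> I \<Longrightarrow> d \<in> space Q \<Longrightarrow> AE \<omega> in M. \<bar>G (\<theta> i \<omega>, d)\<bar> \<le> c"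
  shows "(\<integral>\<^sup>+\<omega>. ennreal ((\<Sum>i\<in>I. G (\<theta> i \<omega>, D \<omega>))\<^sup>2) \<partial>M) \<le> ennreal (real (card I) * c\<^sup>2)"
proof -
  define F where "F p = ennreal ((\<Sum>i\<in>I. G (fst p i, snd p))\<^sup>2)" for p
  have [measurable]: "F \<in> borel_measurable ((\<Pi>\<^sub>M i\<in>I. T) \<Otimes>\<^sub>M Q)"
    unfolding F_def by measurable
  have "(\<integral>\<^sup>+\<omega>. ennreal ((\<Sum>i\<in>I. G (\<theta> i \<omega>, D \<omega>))\<^sup>2) \<partial>M) = (\<integral>\<^sup>+\<omega>. F ((\<lambda>i\<in>I. \<theta> i \<omega>), D \<omega>) \<partial>M)"
    by (simp add: F_def)
  also have "\<dots> = (\<integral>\<^sup>+\<omega>. (\<integral>\<^sup>+\<omega>'. F ((\<lambda>i\<in>I. \<theta> i \<omega>'), D \<omega>) \<partial>M) \<partial>M)"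
    by (rule indep_rv_nn_integral[OF indD]) measurable
  also have "\<dots> \<le> (\<integral>\<^sup>+\<omega>. ennreal (real (card I) * c\<^sup>2) \<partial>M)"
  proof (rule nn_integral_mono)
    fix \<omega> assume "\<omega> \<in> space M"
    then have d: "D \<omega> \<in> space Q" using indep_rvD(2)[OF indD] by (rule measurable_space[rotated])
    have "(\<lambda>t. G (t, D \<omega>)) \<in> borel_measurable T" using d by measurable
    then have iv: "indep_vars (\<lambda>_. borel) (\<lambda>i \<omega>'. G (\<theta> i \<omega>', D \<omega>)) I"
      by (intro indep_vars_compose2[OF ind])
    note sm = second_moment_indep_sum_le[OF \<open>finite I\<close> iv mean[OF _ d] bnd[OF _ d]]
    have "(\<integral>\<^sup>+\<omega>'. F ((\<lambda>i\<in>I. \<theta> i \<omega>'), D \<omega>) \<partial>M) = (\<integral>\<^sup>+\<omega>'. ennreal ((\<Sum>i\<in>I. G (\<theta> i \<omega>', D \<omega>))\<^sup>2) \<partial>M)"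
      by (simp add: F_def)
    also have "\<dots> = ennreal (expectation (\<lambda>\<omega>'. (\<Sum>i\<in>I. G (\<theta> i \<omega>', D \<omega>))\<^sup>2))"
      using sm(1) by (intro nn_integral_eq_integral) auto
    also have "\<dots> \<le> ennreal (real (card I) * c\<^sup>2)" using sm(2) by (intro ennreal_leI)
    finally show "(\<integral>\<^sup>+\<omega>'. F ((\<lambda>i\<in>I. \<theta> i \<omega>'), D \<omega>) \<partial>M) \<le> ennreal (real (card I) * c\<^sup>2)" .
  qed
  also have "\<dots> = ennreal (real (card I) * c\<^sup>2)" by (simp add: emeasure_space_1)
  finally show ?thesis .
qed

end

text \<open>By induction, with measurability of a parameter integral in its parameter at each step.
  The space \<open>Q\<close> is arbitrary because the memory is viewed both as a random variable and
  as a function on the path space of the data.\<close>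

lemma measurable_mean_field_memory:
  fixes x :: "'b \<Rightarrow> nat \<Rightarrow> real ^ 'd::finite"
  assumes [measurable]: "\<sigma> \<in> borel_measurable borel" and lam: "prob_space lamW" "sets lamW = sets borel"
    and x[measurable]: "\<And>l. (\<lambda>d. x d l) \<in> borel_measurable Q"
  shows "(\<lambda>d. mean_field_memory \<sigma> \<mu>b lamW (x d) k) \<in> borel_measurable Q"
proof (induction k)
  case (Suc k)
  note [measurable] = Suc
  interpret prob_space lamW by fact
  have [measurable]: "(\<lambda>w. w) \<in> measurable lamW borel" by (simp add: measurable_ident_sets lam(2))
  show ?case by simp
qed simp

lemma measurable_untrained_memory:
  fixes x :: "'b \<Rightarrow> nat \<Rightarrow> real ^ 'd::finite"
  assumes [measurable]: "\<sigma> \<in> borel_measurable borel"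
    and x[measurable]: "\<And>l. (\<lambda>d. x d l) \<in> borel_measurable Q"
    and w[measurable]: "\<And>i. i \<in> {1..N} \<Longrightarrow> (\<lambda>d. w d i) \<in> borel_measurable Q"
    and b[measurable]: "\<And>i. i \<in> {1..N} \<Longrightarrow> (\<lambda>d. b d i) \<in> borel_measurable Q"
  shows "(\<lambda>d. untrained_memory \<sigma> N (w d) (b d) (x d) k) \<in> borel_measurable Q"
proof (induction k)
  case (Suc k)
  show ?case unfolding untrained_memory.simps
    by (intro borel_measurable_times borel_measurable_const borel_measurable_sum
        measurable_compose[OF _ assms(1)] borel_measurable_add borel_measurable_inner x w b Suc)
qed simp

lemma abs_untrained_memory_le:
  assumes N: "N \<ge> 1" and "\<And>z. \<bar>\<sigma> z\<bar> \<le> S" and b0: "\<And>i. i \<in> {1..N} \<Longrightarrow> \<bar>b0 i\<bar> \<le> Kb"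
  shows "\<bar>untrained_memory \<sigma> N w0 b0 x k\<bar> \<le> Kb * S"
proof (cases k)
  case 0
  have "0 \<le> S" using assms(2)[of 0] by linarith
  moreover have "0 \<le> Kb" using b0[of 1] N by simp
  ultimately show ?thesis using 0 by simp
next
  case (Suc l)
  show ?thesis unfolding Suc untrained_memory.simps
    using assms(2) b0 by (intro average_bound N) (force simp: abs_mult intro!: mult_mono)
qed

lemma abs_mean_field_memory_le:
  assumes "prob_space lamW" and S: "\<And>z. \<bar>\<sigma> z\<bar> \<le> S"
  shows "\<bar>mean_field_memory \<sigma> \<mu>b lamW x k\<bar> \<le> \<bar>\<mu>b\<bar> * S"
proof (cases k)
  case 0
  have "0 \<le> S" using S[of 0] by linarith
  then show ?thesis using 0 by simp
next
  case (Suc l)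
  interpret prob_space lamW by fact
  have "\<bar>expectation (\<lambda>w. \<sigma> (w \<bullet> x l + r))\<bar> \<le> S" for r
  proof (cases "integrable lamW (\<lambda>w. \<sigma> (w \<bullet> x l + r))")
    case True
    have "\<bar>expectation (\<lambda>w. \<sigma> (w \<bullet> x l + r))\<bar> \<le> expectation (\<lambda>w. \<bar>\<sigma> (w \<bullet> x l + r)\<bar>)"
      by (rule integral_abs_bound)
    also have "\<dots> \<le> expectation (\<lambda>_. S)" using True S by (intro integral_mono) auto
    finally show ?thesis by (simp add: prob_space)
  next
    \<comment> \<open>The integral of a non-integrable function has the default value 0, which
      satisfies the bound as well.\<close>
    case False
    have "0 \<le> S" using S[of 0] by linarith
    then show ?thesis using False by (simp add: not_integrable_integral_eq)
  qed
  then show ?thesis unfolding Suc mean_field_memory.simps by (auto simp: abs_mult intro!: mult_left_mono)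
qed

theorem lemma3p1:
  fixes M :: "'a measure"
    and X :: "nat \<Rightarrow> 'a \<Rightarrow> real ^ 'd::finite"
    and Z :: "nat \<Rightarrow> 'a \<Rightarrow> real ^ 'dz::finite"
    and \<eta> :: "nat \<Rightarrow> 'a \<Rightarrow> real ^ 'de::finite"
    and P :: "(real ^ 'd) \<times> (real ^ 'dz) \<Rightarrow> ((real ^ 'd) \<times> (real ^ 'dz)) measure"
    and f :: "(real ^ 'd) \<times> (real ^ 'dz) \<times> (real ^ 'de) \<Rightarrow> real"
    and Y :: "nat \<Rightarrow> 'a \<Rightarrow> real"
    and \<sigma> :: "real \<Rightarrow> real" and \<psi> :: "nat \<Rightarrow> real \<Rightarrow> real"
    and C0 B0 :: "nat \<Rightarrow> nat \<Rightarrow> 'a \<Rightarrow> real" and W0 :: "nat \<Rightarrow> nat \<Rightarrow> 'a \<Rightarrow> real ^ 'd"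
    and lam :: "(real \<times> (real ^ 'd) \<times> real) measure" and lamW :: "(real ^ 'd) measure"
    and L Cx Csig Kc Kb \<mu>b \<mu>b2 \<mu>c2 \<mu>w2 \<alpha> \<beta> \<gamma> :: real
    and st :: "nat \<Rightarrow> 'a \<Rightarrow> nat \<Rightarrow> 'd rnn_state"
    and v uN :: "nat \<Rightarrow> nat \<Rightarrow> 'a \<Rightarrow> real" and u :: "nat \<Rightarrow> 'a \<Rightarrow> real"
    and V HN :: "nat \<Rightarrow> nat \<Rightarrow> 'a \<Rightarrow> (real ^ 'd) \<times> (real ^ 'dz) \<times> real \<times> real"
    and H :: "nat \<Rightarrow> 'a \<Rightarrow> (real ^ 'd) \<times> (real ^ 'dz) \<times> real \<times> real"
  assumes prob: "prob_space M"
    \<comment> \<open>data\<close>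
    and markov: "markov_chain M P (\<lambda>k \<omega>. (X k \<omega>, Z k \<omega>))"
    and eta_indep: "prob_space.indep_vars M (\<lambda>_. borel) \<eta> UNIV"
    and eta_distr: "\<And>k. distr M borel (\<eta> k) = distr M borel (\<eta> 0)"
    and eta_XZ_indep: "indep_rv M (\<Pi>\<^sub>M k\<in>UNIV. borel) (\<lambda>\<omega> k. \<eta> k \<omega>)
                                  (\<Pi>\<^sub>M k\<in>UNIV. borel) (\<lambda>\<omega> k. (X k \<omega>, Z k \<omega>))"
    and Y: "\<And>k \<omega>. Y k \<omega> = f (X k \<omega>, Z k \<omega>, \<eta> k \<omega>)"
    and L: "0 \<le> L" "L < 1"
    and contraction: "\<And>p q. wasserstein2 (P p) (P q) \<le> ennreal (L * norm (p - q))"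
    and XZ_bounded: "\<And>k. AE \<omega> in M. norm (X k \<omega>, Z k \<omega>) \<le> Cx"
    and eta_moment: "\<And>k. integrable M (\<lambda>\<omega>. (norm (\<eta> k \<omega>))\<^sup>2)"
    and f_bounded: "bounded (range f)"
    and f_lipschitz: "\<exists>Lf. lipschitz_on Lf UNIV f"
    \<comment> \<open>activation and initialisation\<close>
    and sigma: "C2b \<sigma>"
    and Csig: "Csig = (SUP x. \<bar>deriv \<sigma> x\<bar>)"
    and init_indep: "\<And>N. N \<ge> 1 \<Longrightarrow> prob_space.indep_vars M (\<lambda>_. borel)
                        (\<lambda>i \<omega>. (C0 N i \<omega>, W0 N i \<omega>, B0 N i \<omega>)) {1..N}"
    and init_law: "\<And>N i. N \<ge> 1 \<Longrightarrow> i \<in> {1..N} \<Longrightarrow>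
                     distr M borel (\<lambda>\<omega>. (C0 N i \<omega>, W0 N i \<omega>, B0 N i \<omega>)) = lam"
    and lam_ac: "absolutely_continuous lborel lam"
    and init_data_indep: "\<And>N. N \<ge> 1 \<Longrightarrow>
          indep_rv M (\<Pi>\<^sub>M i\<in>{1..N}. borel) (\<lambda>\<omega>. \<lambda>i\<in>{1..N}. (C0 N i \<omega>, W0 N i \<omega>, B0 N i \<omega>))
                     (\<Pi>\<^sub>M k\<in>UNIV. borel) (\<lambda>\<omega> k. (X k \<omega>, Z k \<omega>, \<eta> k \<omega>))"
    and init_comp_indep: "\<And>N i. N \<ge> 1 \<Longrightarrow> i \<in> {1..N} \<Longrightarrow>
          indep_rv3 M borel (C0 N i) borel (W0 N i) borel (B0 N i)"
    and C0_bounded: "\<And>N i. N \<ge> 1 \<Longrightarrow> i \<in> {1..N} \<Longrightarrow> AE \<omega> in M. \<bar>C0 N i \<omega>\<bar> \<le> Kc"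
    and C0_mean: "\<And>N i. N \<ge> 1 \<Longrightarrow> i \<in> {1..N} \<Longrightarrow> (\<integral>\<omega>. C0 N i \<omega> \<partial>M) = 0"
    and C0_second: "\<And>N i. N \<ge> 1 \<Longrightarrow> i \<in> {1..N} \<Longrightarrow> (\<integral>\<omega>. (C0 N i \<omega>)\<^sup>2 \<partial>M) = \<mu>c2"
    and B0_bounded: "\<And>N i. N \<ge> 1 \<Longrightarrow> i \<in> {1..N} \<Longrightarrow> AE \<omega> in M. \<bar>B0 N i \<omega>\<bar> \<le> Kb"
    and B0_mean: "\<And>N i. N \<ge> 1 \<Longrightarrow> i \<in> {1..N} \<Longrightarrow> (\<integral>\<omega>. B0 N i \<omega> \<partial>M) = \<mu>b"
    and B0_second: "\<And>N i. N \<ge> 1 \<Longrightarrow> i \<in> {1..N} \<Longrightarrow> (\<integral>\<omega>. (B0 N i \<omega>)\<^sup>2 \<partial>M) = \<mu>b2"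
    and W0_second: "\<And>N i. N \<ge> 1 \<Longrightarrow> i \<in> {1..N} \<Longrightarrow>
          has_bochner_integral M (\<lambda>\<omega>. (norm (W0 N i \<omega>))\<^sup>2) \<mu>w2"
    and const_pos: "0 < Kc" "0 < Kb" "0 < \<mu>c2" "0 < \<mu>b" "0 < \<mu>b2" "0 < \<mu>w2"
    and const_le: "\<mu>b\<^sup>2 \<le> \<mu>b2" "\<mu>b2 \<le> Kb\<^sup>2" "\<mu>c2 \<le> Kc\<^sup>2"
    and small: "2 * Kb\<^sup>2 * Csig\<^sup>2 < 1"
    and q0: "sqrt (max (L\<^sup>2 + 2 * \<mu>b\<^sup>2 * \<mu>w2 * Csig\<^sup>2) (2 * \<mu>b\<^sup>2 * Csig\<^sup>2)) < 1"
    and lamW: "lamW = distr lam borel (\<lambda>(c, w, b). w)"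
    \<comment> \<open>training\<close>
    and alpha: "0 < \<alpha>"
    and beta: "1 / 2 < \<beta>" "\<beta> < 1"
    and gamma: "0 < \<gamma>" "\<gamma> < (1 - \<beta>) / 2"
    and psi_C2b: "\<And>N. N \<ge> 1 \<Longrightarrow> C2b (\<psi> N)"
    and psi_bound: "\<And>N x. N \<ge> 1 \<Longrightarrow> \<bar>\<psi> N x\<bar> \<le> 2 * real N powr \<gamma>"
    and psi_id: "\<And>N x. N \<ge> 1 \<Longrightarrow> \<bar>x\<bar> \<le> real N powr \<gamma> \<Longrightarrow> \<psi> N x = x"
    and psi_deriv: "\<And>N x. N \<ge> 1 \<Longrightarrow> \<bar>deriv (\<psi> N) x\<bar> \<le> 1"
    and st: "\<And>N \<omega>. st N \<omega> = rnn_train \<sigma> (\<psi> N) \<alpha> \<beta> N (\<lambda>k. X k \<omega>) (\<lambda>k. Y k \<omega>)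
                             (\<lambda>i. C0 N i \<omega>) (\<lambda>i. W0 N i \<omega>) (\<lambda>i. B0 N i \<omega>)"
    \<comment> \<open>memory terms\<close>
    and v: "\<And>N k \<omega>. v N k \<omega> = trained_memory \<sigma> N (st N \<omega>) (\<lambda>l. X l \<omega>) k"
    and uN: "\<And>N k \<omega>. uN N k \<omega> =
               untrained_memory \<sigma> N (\<lambda>i. W0 N i \<omega>) (\<lambda>i. B0 N i \<omega>) (\<lambda>l. X l \<omega>) k"
    and u: "\<And>k \<omega>. u k \<omega> = mean_field_memory \<sigma> \<mu>b lamW (\<lambda>l. X l \<omega>) k"
    and V: "\<And>N k \<omega>. V N k \<omega> = (X k \<omega>, Z k \<omega>, Y k \<omega>, v N k \<omega>)"
    and HN: "\<And>N k \<omega>. HN N k \<omega> = (X k \<omega>, Z k \<omega>, Y k \<omega>, uN N k \<omega>)"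
    and H: "\<And>k \<omega>. H k \<omega> = (X k \<omega>, Z k \<omega>, Y k \<omega>, u k \<omega>)"
  shows "(\<forall>T>0. \<exists>CT>0. \<forall>N\<ge>1. AE \<omega> in M. \<forall>k. real k \<le> real N * T \<longrightarrow>
            norm (V N k \<omega> - HN N k \<omega>) = \<bar>v N k \<omega> - uN N k \<omega>\<bar> \<and>
            \<bar>v N k \<omega> - uN N k \<omega>\<bar> \<le> CT / real N powr (1 - \<beta> - \<gamma>)) \<and>
         (\<exists>C>0. \<forall>N\<ge>1. \<forall>k.
            integrable M (\<lambda>\<omega>. (norm (HN N k \<omega> - H k \<omega>))\<^sup>2) \<and>
            (\<integral>\<omega>. (norm (HN N k \<omega> - H k \<omega>))\<^sup>2 \<partial>M) = (\<integral>\<omega>. \<bar>uN N k \<omega> - u k \<omega>\<bar>\<^sup>2 \<partial>M) \<and>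
            (\<integral>\<omega>. \<bar>uN N k \<omega> - u k \<omega>\<bar>\<^sup>2 \<partial>M) \<le> C / real N)"
proof -

  \<comment> \<open>Constants, measurability and almost sure bounds\<close>
  interpret prob_space M by (fact prob)
  obtain S where S: "0 \<le> S" "\<And>z. \<bar>\<sigma> z\<bar> \<le> S"
    and dsig: "\<And>z. \<bar>deriv \<sigma> z\<bar> \<le> Csig"
    and lip: "\<And>z z'. \<bar>\<sigma> z - \<sigma> z'\<bar> \<le> Csig * \<bar>z - z'\<bar>"
    and msig[measurable]: "\<sigma> \<in> borel_measurable borel"
    using C2bE[OF sigma] unfolding Csig[symmetric] by metis
  have Csig0: "0 \<le> Csig" using dsig[of 0] by linarith
  have Kb0: "0 \<le> Kb" and \<mu>b0: "0 \<le> \<mu>b" using const_pos by auto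
  have \<mu>bKb: "\<mu>b \<le> Kb"
    using const_le(1,2) Kb0 by (intro power2_le_imp_le[of \<mu>b Kb]) auto
  \<comment> \<open>The hypothesis \<open>small\<close> bounds twice the square of this factor. The
    pathwise comparison uses only the factor itself; the mean square recursion uses the full
    strength.\<close>
  have q: "Kb * Csig < 1"
  proof (rule power2_less_imp_less[of _ 1])
    show "(Kb * Csig)\<^sup>2 < 1\<^sup>2"
      using small zero_le_power2[of "Kb * Csig"] by (simp add: power_mult_distrib)
  qed simp
  have mX[measurable]: "X k \<in> borel_measurable M" for k
  proof -
    have "(\<lambda>\<omega>. (X k \<omega>, Z k \<omega>)) \<in> borel_measurable M"
      using markov by (simp add: markov_chain_def)
    then have "(\<lambda>\<omega>. fst (X k \<omega>, Z k \<omega>)) \<in> borel_measurable M"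
      by (rule measurable_compose) (simp add: borel_measurable_continuous_onI continuous_on_fst)
    then show ?thesis by simp
  qed
  have mfst: "(\<lambda>t :: real \<times> (real ^ 'd) \<times> real. fst (snd t)) \<in> borel_measurable borel"
    and msnd: "(\<lambda>t :: real \<times> (real ^ 'd) \<times> real. snd (snd t)) \<in> borel_measurable borel"
    by (auto intro!: borel_measurable_continuous_onI continuous_intros)
  have m\<theta>: "(\<lambda>\<omega>. (C0 N i \<omega>, W0 N i \<omega>, B0 N i \<omega>)) \<in> borel_measurable M" if "N \<ge> 1" "i \<in> {1..N}" for N i
    using init_indep[OF that(1)] that(2) by (auto simp: indep_vars_def)
  have mW: "W0 N i \<in> borel_measurable M" and mB: "B0 N i \<in> borel_measurable M"
    if "N \<ge> 1" "i \<in> {1..N}" for N i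
    using measurable_compose[OF m\<theta>[OF that] mfst] measurable_compose[OF m\<theta>[OF that] msnd] by simp_all
  \<comment> \<open>\<open>init_law\<close> makes \<open>lam\<close> the joint law of the parameters
    of every unit, so its marginal is the law of any \<open>W0 N i\<close>, independently of
    \<open>N\<close> and \<open>i\<close>.\<close>
  have lamW_eq: "lamW = distr M borel (W0 N i)" if "N \<ge> 1" "i \<in> {1..N}" for N i
  proof -
    have "lamW = distr (distr M borel (\<lambda>\<omega>. (C0 N i \<omega>, W0 N i \<omega>, B0 N i \<omega>))) borel (\<lambda>t. fst (snd t))"
      unfolding lamW init_law[OF that] by (simp add: case_prod_unfold)
    also have "\<dots> = distr M borel (W0 N i)"
      using m\<theta>[OF that] mfst by (simp add: distr_distr comp_def)
    finally show ?thesis .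
  qed
  have lamW_prob: "prob_space lamW" and lamW_sets: "sets lamW = sets borel"
    using lamW_eq[of 1 1] mW[of 1 1] by (auto intro: prob_space_distr)
  \<comment> \<open>One null set has to serve all times, since the pathwise lemmas follow a whole
    trajectory; the times are countable.\<close>
  have AE_X: "AE \<omega> in M. \<forall>k. norm (X k \<omega>) \<le> Cx"
    unfolding AE_all_countable
  proof
    fix k show "AE \<omega> in M. norm (X k \<omega>) \<le> Cx"
      using XZ_bounded[of k] by eventually_elim (metis norm_fst_le order_trans)
  qed
  have AE_B: "AE \<omega> in M. \<forall>i\<in>{1..N}. \<bar>B0 N i \<omega>\<bar> \<le> Kb" if "N \<ge> 1" for N
    using B0_bounded[OF that] by (intro AE_finite_allI) auto
  have AE_C: "AE \<omega> in M. \<forall>i\<in>{1..N}. \<bar>C0 N i \<omega>\<bar> \<le> Kc" if "N \<ge> 1" for N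
    using C0_bounded[OF that] by (intro AE_finite_allI) auto
  obtain Cy where Cy: "\<And>p. \<bar>f p\<bar> \<le> Cy" using f_bounded by (auto simp: bounded_iff)
  have dist1: "norm (V N k \<omega> - HN N k \<omega>) = \<bar>v N k \<omega> - uN N k \<omega>\<bar>"
    and dist2: "norm (HN N k \<omega> - H k \<omega>) = \<bar>uN N k \<omega> - u k \<omega>\<bar>" for N k \<omega>
    unfolding V HN H by (simp_all add: norm_Pair)

  \<comment> \<open>Trained against untrained memory, path by path\<close>
  have part1: "\<exists>CT>0. \<forall>N\<ge>1. AE \<omega> in M. \<forall>k. real k \<le> real N * T \<longrightarrow>
            norm (V N k \<omega> - HN N k \<omega>) = \<bar>v N k \<omega> - uN N k \<omega>\<bar> \<and>
            \<bar>v N k \<omega> - uN N k \<omega>\<bar> \<le> CT / real N powr (1 - \<beta> - \<gamma>)" if T: "T > 0" for T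
  proof -
    define R where "R = T * \<alpha> * (2 + Cy)"
    define KC where "KC = Kc + R * S"
    \<comment> \<open>\<open>A\<close> is the bound of \<open>trained_untrained_memory_bound\<close>
      with the common factor \<open>\<delta>\<close> of both weight deviations taken out, so it
      depends on \<open>T\<close> but not on \<open>N\<close>. Passing to
      \<open>\<bar>A\<bar> + 1\<close> below makes the constant positive without a discussion of
      signs.\<close>
    define A where "A = (R * KC * S * Csig * S + Kb * Csig * Cx * (R * KC * Csig * Cx)) / (1 - Kb * Csig)"
    have "AE \<omega> in M. \<forall>k. real k \<le> real N * T \<longrightarrow>
            \<bar>v N k \<omega> - uN N k \<omega>\<bar> \<le> (\<bar>A\<bar> + 1) / real N powr (1 - \<beta> - \<gamma>)" if N: "N \<ge> 1" for N
      using AE_X AE_B[OF N] AE_C[OF N]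
    proof eventually_elim
      case (elim \<omega>)
      show ?case
      proof (intro allI impI)
        fix K assume K: "real K \<le> real N * T"
        define \<delta> where "\<delta> = real N powr (\<beta> + \<gamma> - 1)"
        have \<delta>: "\<delta> = 1 / real N powr (1 - \<beta> - \<gamma>)"
          unfolding \<delta>_def using powr_minus_divide[of "real N" "1 - \<beta> - \<gamma>"] by (simp add: algebra_simps)
        have before: "real k \<le> real N * T" if "k \<le> K" for k using that K by linarith
        have \<gamma>: "0 \<le> \<gamma>" "\<beta> + \<gamma> \<le> 1" using beta gamma by auto
        have y: "\<bar>Y l \<omega>\<bar> \<le> Cy" for l by (simp add: Y Cy)
        have x: "norm (X l \<omega>) \<le> Cx" for l using elim by blast
        have c0: "\<bar>C0 N i \<omega>\<bar> \<le> Kc" if "i \<in> {1..N}" for i using elim that by blast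
        note dev = rnn_train_deviation[where \<sigma>=\<sigma> and \<psi>="\<psi> N" and x="\<lambda>l. X l \<omega>" and y="\<lambda>l. Y l \<omega>"
            and \<beta>=\<beta> and Cy=Cy and Cx=Cx and Kc=Kc and ?c0.0="\<lambda>i. C0 N i \<omega>",
            OF N less_imp_le[OF alpha] \<gamma> less_imp_le[OF T] S dsig psi_bound[OF N] y x c0 before,
            folded R_def, folded KC_def \<delta>_def]
        have W: "norm (Wpar (st N \<omega> k) i - W0 N i \<omega>) \<le> R * KC * Csig * Cx * \<delta>"
          and B: "\<bar>Bpar (st N \<omega> k) i - B0 N i \<omega>\<bar> \<le> R * KC * S * Csig * \<delta>"
          if "k \<le> K" "i \<in> {1..N}" for k i
          unfolding st using that by (auto intro: dev)
        have b0: "\<bar>B0 N i \<omega>\<bar> \<le> Kb" if "i \<in> {1..N}" for i using elim that by blast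
        have "\<bar>v N K \<omega> - uN N K \<omega>\<bar>
          \<le> (R * KC * S * Csig * \<delta> * S + Kb * Csig * Cx * (R * KC * Csig * Cx * \<delta>)) / (1 - Kb * Csig)"
          unfolding v uN
          by (rule trained_untrained_memory_bound[OF N S lip x b0 q W B])
        also have "\<dots> = A * \<delta>"
          by (simp add: A_def algebra_simps add_divide_distrib)
        also have "\<dots> \<le> (\<bar>A\<bar> + 1) * \<delta>" by (intro mult_right_mono) (auto simp: \<delta>_def)
        finally show "\<bar>v N K \<omega> - uN N K \<omega>\<bar> \<le> (\<bar>A\<bar> + 1) / real N powr (1 - \<beta> - \<gamma>)"
          by (simp add: \<delta>)
      qed
    qed
    then show ?thesis
      by (intro exI[of _ "\<bar>A\<bar> + 1"]) (simp add: dist1)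
  qed

  \<comment> \<open>Measurability, boundedness and integrability of the mean-field error\<close>
  have mu[measurable]: "u k \<in> borel_measurable M" for k
    using measurable_mean_field_memory[OF msig lamW_prob lamW_sets, where x="\<lambda>\<omega> l. X l \<omega>" and Q=M and \<mu>b=\<mu>b and k=k] mX
    by (simp add: u[symmetric])
  have muN: "uN N k \<in> borel_measurable M" if "N \<ge> 1" for N k
    using measurable_untrained_memory[OF msig, of "\<lambda>\<omega> l. X l \<omega>" M N "\<lambda>\<omega> i. W0 N i \<omega>" "\<lambda>\<omega> i. B0 N i \<omega>" k]
      mX mW[OF that] mB[OF that]
    by (simp add: uN[symmetric])
  \<comment> \<open>This bounds the difference of the two memories and, with the same computation,
    each centred term of the fluctuation.\<close>
  define c where "c = (Kb + \<mu>b) * S"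
  have AE_diff: "AE \<omega> in M. \<bar>uN N k \<omega> - u k \<omega>\<bar> \<le> c" if N: "N \<ge> 1" for N k
    using AE_B[OF N]
  proof eventually_elim
    case (elim \<omega>)
    have "\<bar>uN N k \<omega>\<bar> \<le> Kb * S"
      unfolding uN using elim by (intro abs_untrained_memory_le N S) auto
    moreover have "\<bar>u k \<omega>\<bar> \<le> \<mu>b * S"
      using abs_mean_field_memory_le[where \<sigma>=\<sigma>, OF lamW_prob S(2), where \<mu>b=\<mu>b] \<mu>b0 by (simp add: u)
    ultimately show ?case by (simp add: c_def algebra_simps)
  qed
  have int_diff: "integrable M (\<lambda>\<omega>. (uN N k \<omega> - u k \<omega>)\<^sup>2)" if N: "N \<ge> 1" for N k
  proof (rule integrable_const_bound[where B="c\<^sup>2"])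
    show "AE \<omega> in M. norm ((uN N k \<omega> - u k \<omega>)\<^sup>2) \<le> c\<^sup>2"
      using AE_diff[OF N, of k] by eventually_elim (simp add: abs_le_square_iff[symmetric])
  qed (use muN[OF N] in measurable)

  \<comment> \<open>Fluctuation around the mean field, with the data frozen\<close>
  define \<xi> where "\<xi> N k i \<omega> = B0 N i \<omega> * \<sigma> (W0 N i \<omega> \<bullet> X k \<omega> + u k \<omega>)
      - \<mu>b * (\<integral>w. \<sigma> (w \<bullet> X k \<omega> + u k \<omega>) \<partial>lamW)" for N k i \<omega>
  \<comment> \<open>The activation in \<open>\<xi>\<close> is evaluated at \<open>u k\<close> and
    not at \<open>uN N k\<close>. The mean-field memory is a function of the data alone, so frozen
    data leave independent terms; \<open>uN N k\<close> depends on the weights of all units and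
    would couple them.\<close>
  have fluct: "integrable M (\<lambda>\<omega>. (\<Sum>i=1..N. \<xi> N k i \<omega>)\<^sup>2)"
    "expectation (\<lambda>\<omega>. (\<Sum>i=1..N. \<xi> N k i \<omega>)\<^sup>2) \<le> real N * c\<^sup>2" if N: "N \<ge> 1" for N k
  proof -
    interpret lw: prob_space lamW by (fact lamW_prob)
    define Q where "Q = (\<Pi>\<^sub>M k\<in>(UNIV :: nat set). (borel :: ((real ^ 'd) \<times> (real ^ 'dz) \<times> (real ^ 'de)) measure))"
    define D where "D \<omega> k = (X k \<omega>, Z k \<omega>, \<eta> k \<omega>)" for \<omega> k
    define U where "U d = mean_field_memory \<sigma> \<mu>b lamW (\<lambda>l. fst (d l)) k"
      for d :: "nat \<Rightarrow> (real ^ 'd) \<times> (real ^ 'dz) \<times> (real ^ 'de)"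
    \<comment> \<open>\<open>G\<close> is \<open>\<xi>\<close> as a function of the parameters
      \<open>t\<close> of one unit and a data path \<open>d\<close>. The path includes the noise
      because independence from the initialisation is stated for the joint process.\<close>
    define G where "G p = (case p of (t, d) \<Rightarrow> snd (snd t) * \<sigma> (fst (snd t) \<bullet> fst (d k) + U d)
        - \<mu>b * (\<integral>w. \<sigma> (w \<bullet> fst (d k) + U d) \<partial>lamW))"
      for p :: "(real \<times> (real ^ 'd) \<times> real) \<times> (nat \<Rightarrow> (real ^ 'd) \<times> (real ^ 'dz) \<times> (real ^ 'de))"
    define \<theta> where "\<theta> i \<omega> = (C0 N i \<omega>, W0 N i \<omega>, B0 N i \<omega>)" for i \<omega>
    have Dl[measurable]: "(\<lambda>d. fst (d l)) \<in> borel_measurable Q" for l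
      unfolding Q_def by (rule measurable_compose[OF measurable_component_singleton])
        (auto intro!: borel_measurable_continuous_onI continuous_intros)
    have [measurable]: "U \<in> borel_measurable Q"
      unfolding U_def using Dl by (intro measurable_mean_field_memory msig lamW_prob lamW_sets)
    have [measurable]: "(\<lambda>w. w) \<in> measurable lamW borel"
      by (simp add: measurable_ident_sets lamW_sets)
    note [measurable] = mfst msnd
    have G[measurable]: "G \<in> borel_measurable (borel \<Otimes>\<^sub>M Q)"
      unfolding G_def by measurable
    have int_sig: "integrable lamW (\<lambda>w. \<sigma> (w \<bullet> a + r))" for a r
      using S by (intro lw.integrable_const_bound[where B=S]) auto
    have "(\<integral>\<^sup>+\<omega>. ennreal ((\<Sum>i=1..N. G (\<theta> i \<omega>, D \<omega>))\<^sup>2) \<partial>M) \<le> ennreal (real (card {1..N}) * c\<^sup>2)"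
    proof (rule conditional_second_moment_sum_le[where T=borel and Q=Q])
      show "indep_vars (\<lambda>_. borel) \<theta> {1..N}"
        using init_indep[OF N] by (simp add: \<theta>_def[abs_def])
      show "indep_rv M (\<Pi>\<^sub>M i\<in>{1..N}. borel) (\<lambda>\<omega>. \<lambda>i\<in>{1..N}. \<theta> i \<omega>) Q D"
        using init_data_indep[OF N] by (simp add: \<theta>_def[abs_def] Q_def D_def[abs_def])
      show "expectation (\<lambda>\<omega>. G (\<theta> i \<omega>, d)) = 0" if i: "i \<in> {1..N}" for i d
      proof -
        define h where "h w = \<sigma> (w \<bullet> fst (d k) + U d)" for w
        have [measurable]: "h \<in> borel_measurable borel" unfolding h_def by measurable
        note [measurable] = mW[OF N i] mB[OF N i]
        \<comment> \<open>For a frozen path, \<open>h\<close> sees only the inner weight, which is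
          independent of \<open>B0 N i\<close>. The expectation therefore factors into
          \<open>\<mu>b\<close> times the integral of \<open>h\<close> against \<open>lamW\<close>,
          the term subtracted in \<open>G\<close>.\<close>
        have ind: "indep_rv M borel (\<lambda>\<omega>. h (W0 N i \<omega>)) borel (B0 N i)"
          by (rule indep_rv_compose[where f=h and g="\<lambda>b. b", OF indep_rv3_imp_indep_rv[OF init_comp_indep[OF N i]]])
            simp_all
        have ih: "integrable M (\<lambda>\<omega>. h (W0 N i \<omega>))"
          using S by (intro integrable_const_bound[where B=S]) (auto simp: h_def)
        have iB: "integrable M (B0 N i)"
          using B0_bounded[OF N i] by (intro integrable_const_bound[where B=Kb]) auto
        have ihB: "integrable M (\<lambda>\<omega>. h (W0 N i \<omega>) * B0 N i \<omega>)"
        proof (rule integrable_const_bound[where B="S * Kb"])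
          show "AE \<omega> in M. norm (h (W0 N i \<omega>) * B0 N i \<omega>) \<le> S * Kb"
            using B0_bounded[OF N i] by eventually_elim (auto simp: abs_mult h_def S intro!: mult_mono)
        qed measurable
        have "expectation (\<lambda>\<omega>. G (\<theta> i \<omega>, d))
            = expectation (\<lambda>\<omega>. h (W0 N i \<omega>) * B0 N i \<omega> - \<mu>b * (\<integral>w. h w \<partial>lamW))"
          by (simp add: G_def \<theta>_def h_def mult.commute)
        also have "\<dots> = expectation (\<lambda>\<omega>. h (W0 N i \<omega>)) * \<mu>b - \<mu>b * (\<integral>w. h w \<partial>lamW)"
          using ihB indep_rv_expectation_mult[OF ind ih iB] B0_mean[OF N i] by (simp add: prob_space)
        also have "(\<integral>w. h w \<partial>lamW) = expectation (\<lambda>\<omega>. h (W0 N i \<omega>))"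
          unfolding lamW_eq[OF N i] by (rule integral_distr) measurable
        finally show ?thesis by simp
      qed
      show "AE \<omega> in M. \<bar>G (\<theta> i \<omega>, d)\<bar> \<le> c" if i: "i \<in> {1..N}" for i d
        using B0_bounded[OF N i]
      proof eventually_elim
        case (elim \<omega>)
        have "\<bar>\<integral>w. \<sigma> (w \<bullet> fst (d k) + U d) \<partial>lamW\<bar> \<le> (\<integral>w. S \<partial>lamW)"
          using S int_sig
          by (intro order_trans[OF integral_abs_bound integral_mono]) auto
        then have "\<bar>\<mu>b * (\<integral>w. \<sigma> (w \<bullet> fst (d k) + U d) \<partial>lamW)\<bar> \<le> \<mu>b * S"
          using \<mu>b0 by (simp add: abs_mult lw.prob_space mult_left_mono)
        moreover have "\<bar>B0 N i \<omega> * \<sigma> (W0 N i \<omega> \<bullet> fst (d k) + U d)\<bar> \<le> Kb * S"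
          using elim S Kb0 by (simp add: abs_mult mult_mono)
        ultimately show ?case
          by (simp add: G_def \<theta>_def c_def algebra_simps)
      qed
    qed (use G in simp_all)
    moreover have "G (\<theta> i \<omega>, D \<omega>) = \<xi> N k i \<omega>" for i \<omega>
      by (simp add: G_def \<theta>_def D_def \<xi>_def U_def u)
    ultimately have nn: "(\<integral>\<^sup>+\<omega>. ennreal ((\<Sum>i=1..N. \<xi> N k i \<omega>)\<^sup>2) \<partial>M) \<le> ennreal (real N * c\<^sup>2)"
      by simp
    have m\<xi>: "\<xi> N k i \<in> borel_measurable M" if i: "i \<in> {1..N}" for i
    proof -
      note [measurable] = mW[OF N i] mB[OF N i]
      show ?thesis unfolding \<xi>_def[abs_def] by measurable
    qed
    then have msum: "(\<lambda>\<omega>. (\<Sum>i=1..N. \<xi> N k i \<omega>)\<^sup>2) \<in> borel_measurable M"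
      by (intro borel_measurable_power borel_measurable_sum)
    show int: "integrable M (\<lambda>\<omega>. (\<Sum>i=1..N. \<xi> N k i \<omega>)\<^sup>2)"
      using msum le_less_trans[OF nn ennreal_less_top] by (intro integrableI_bounded) simp_all
    show "expectation (\<lambda>\<omega>. (\<Sum>i=1..N. \<xi> N k i \<omega>)\<^sup>2) \<le> real N * c\<^sup>2"
      using nn nn_integral_eq_integral[OF int] by simp
  qed

  \<comment> \<open>Recursion for the mean square error\<close>
  define q where "q = 2 * Kb\<^sup>2 * Csig\<^sup>2"
  have step: "expectation (\<lambda>\<omega>. (uN N (Suc k) \<omega> - u (Suc k) \<omega>)\<^sup>2)
      \<le> q * expectation (\<lambda>\<omega>. (uN N k \<omega> - u k \<omega>)\<^sup>2) + 2 * c\<^sup>2 / real N" if N: "N \<ge> 1" for N k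
  proof -
    have "AE \<omega> in M. (uN N (Suc k) \<omega> - u (Suc k) \<omega>)\<^sup>2
        \<le> q * (uN N k \<omega> - u k \<omega>)\<^sup>2 + 2 / (real N)\<^sup>2 * (\<Sum>i=1..N. \<xi> N k i \<omega>)\<^sup>2"
      using AE_B[OF N]
    proof eventually_elim
      case (elim \<omega>)
      \<comment> \<open>\<open>a\<close> is the propagated error, with the same weights but
        different memories; \<open>b\<close> is the fluctuation at the mean-field memory. The
        elementary bound for the square of \<open>a + b\<close> doubles both squares, hence the
        factor 2 in \<open>q\<close>.\<close>
      define a where "a = 1 / real N * (\<Sum>j=1..N. B0 N j \<omega> *
          (\<sigma> (W0 N j \<omega> \<bullet> X k \<omega> + uN N k \<omega>) - \<sigma> (W0 N j \<omega> \<bullet> X k \<omega> + u k \<omega>)))"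
      define b where "b = 1 / real N * (\<Sum>i=1..N. \<xi> N k i \<omega>)"
      have "uN N (Suc k) \<omega> - u (Suc k) \<omega> = a + b"
        using N by (simp add: a_def b_def uN u \<xi>_def sum_subtractf right_diff_distrib)
      also have "(a + b)\<^sup>2 \<le> 2 * a\<^sup>2 + 2 * b\<^sup>2"
        using zero_le_power2[of "a - b"] by (simp add: power2_eq_square algebra_simps)
      also have "\<bar>a\<bar> \<le> Kb * (Csig * \<bar>uN N k \<omega> - u k \<omega>\<bar>)"
        unfolding a_def
      proof (rule average_bound[OF N])
        fix j assume "j \<in> {1..N}"
        then show "\<bar>B0 N j \<omega> * (\<sigma> (W0 N j \<omega> \<bullet> X k \<omega> + uN N k \<omega>) - \<sigma> (W0 N j \<omega> \<bullet> X k \<omega> + u k \<omega>))\<bar>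
            \<le> Kb * (Csig * \<bar>uN N k \<omega> - u k \<omega>\<bar>)"
          using elim Kb0 lip[of "W0 N j \<omega> \<bullet> X k \<omega> + uN N k \<omega>" "W0 N j \<omega> \<bullet> X k \<omega> + u k \<omega>"]
          unfolding abs_mult by (intro mult_mono) auto
      qed
      then have "a\<^sup>2 \<le> (Kb * (Csig * \<bar>uN N k \<omega> - u k \<omega>\<bar>))\<^sup>2"
        by (metis abs_ge_zero power2_abs power_mono)
      finally show ?case
        by (simp add: q_def b_def power_mult_distrib power_divide)
    qed
    then have "expectation (\<lambda>\<omega>. (uN N (Suc k) \<omega> - u (Suc k) \<omega>)\<^sup>2)
        \<le> expectation (\<lambda>\<omega>. q * (uN N k \<omega> - u k \<omega>)\<^sup>2 + 2 / (real N)\<^sup>2 * (\<Sum>i=1..N. \<xi> N k i \<omega>)\<^sup>2)"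
      using int_diff[OF N] fluct(1)[OF N]
      by (intro integral_mono_AE Bochner_Integration.integrable_add integrable_mult_right) auto
    also have "\<dots> = q * expectation (\<lambda>\<omega>. (uN N k \<omega> - u k \<omega>)\<^sup>2)
        + 2 / (real N)\<^sup>2 * expectation (\<lambda>\<omega>. (\<Sum>i=1..N. \<xi> N k i \<omega>)\<^sup>2)"
      using int_diff[OF N, of k] fluct(1)[OF N, of k] by simp
    also have "\<dots> \<le> q * expectation (\<lambda>\<omega>. (uN N k \<omega> - u k \<omega>)\<^sup>2) + 2 / (real N)\<^sup>2 * (real N * c\<^sup>2)"
      by (intro add_left_mono mult_left_mono fluct(2)[OF N]) auto
    \<comment> \<open>The second moment of the sum grows like \<open>N\<close>, the squared
      normalisation decays like its inverse square: this is the source of the rate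
      \<open>1 / N\<close>.\<close>
    also have "2 / (real N)\<^sup>2 * (real N * c\<^sup>2) = 2 * c\<^sup>2 / real N"
      using N by (simp add: power2_eq_square)
    finally show ?thesis .
  qed
  have "expectation (\<lambda>\<omega>. (uN N k \<omega> - u k \<omega>)\<^sup>2) \<le> (2 * c\<^sup>2 / (1 - q) + 1) / real N" if N: "N \<ge> 1" for N k
  proof -
    \<comment> \<open>Both memories start at 0, so the recursion starts at 0; the horizon is taken
      to be \<open>k\<close> itself, and the bound does not depend on it.\<close>
    have "expectation (\<lambda>\<omega>. (uN N k \<omega> - u k \<omega>)\<^sup>2) \<le> 2 * c\<^sup>2 / real N / (1 - q)"
      using small step[OF N]
      by (intro affine_recursion_bound[where K=k]) (auto simp: q_def uN u)
    also have "\<dots> \<le> (2 * c\<^sup>2 / (1 - q) + 1) / real N" by (simp add: add_divide_distrib mult.commute)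
    finally show ?thesis .
  qed
  \<comment> \<open>The added 1 keeps the constant positive even when \<open>c = 0\<close>, which
    occurs if \<open>S = 0\<close>.\<close>
  moreover have "0 < 2 * c\<^sup>2 / (1 - q) + 1" using small by (intro add_nonneg_pos) (auto simp: q_def)
  ultimately have "\<exists>C>0. \<forall>N\<ge>1. \<forall>k.
            integrable M (\<lambda>\<omega>. (norm (HN N k \<omega> - H k \<omega>))\<^sup>2) \<and>
            (\<integral>\<omega>. (norm (HN N k \<omega> - H k \<omega>))\<^sup>2 \<partial>M) = (\<integral>\<omega>. \<bar>uN N k \<omega> - u k \<omega>\<bar>\<^sup>2 \<partial>M) \<and>
            (\<integral>\<omega>. \<bar>uN N k \<omega> - u k \<omega>\<bar>\<^sup>2 \<partial>M) \<le> C / real N"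
    using int_diff by (intro exI[of _ "2 * c\<^sup>2 / (1 - q) + 1"]) (simp add: dist2)
  with part1 show ?thesis by blast
qed

end
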